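(* Let $X$ be a nonprecompact metric space whose completion is locally compact. Then $\mathrm{PK}(X)\approx \mathrm{Fin}(\mathrm{d}(X))$.
   Context: A metric space (or subset) is precompact if it is totally bounded, i.e. for each $\epsilon>0$ it is covered by finitely many $\epsilon$-balls. $\mathrm{PK}(X)$ is the family of precompact subsets of $X$, partially ordered by inclusion. $\mathrm{d}(X)$, the density of $X$, is the minimal cardinality of a dense subset of $X$. For a set $S$, $\mathrm{Fin}(S)$ is the set of finite subsets of $S$, partially ordered by inclusion (a cardinal is regarded as a set, namely as an initial ordinal). A subset $C$ of a partially ordered set $Q$ is cofinal if for each $q\in Q$ there is $c\in C$ with $q\le c$. For partially ordered sets $P,Q$, write $P\preceq Q$ if there is a monotone (order-preserving) map $\psi\colon P\to Q$ that is cofinal (its image is cofinal in $Q$). $P$ and $Q$ are cofinally equivalent, $P\approx Q$, if $P\preceq Q$ and $Q\preceq P$. *)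

theory Defs
  imports "HOL-Analysis.Analysis"
begin

definition precompact_in :: "'a metric \<Rightarrow> 'a set \<Rightarrow> bool" where
  "precompact_in X S \<longleftrightarrow> Metric_space.mtotally_bounded (mspace X) (mdist X) S"

text \<open>The library requires the centres of the balls to lie in the covered set. Allowing arbitrary
  centres in the ambient space gives the same notion.\<close>

lemma precompact_in_iff:
  "precompact_in X S \<longleftrightarrow> S \<subseteq> mspace X \<and>
    (\<forall>\<epsilon>>0. \<exists>K. finite K \<and> K \<subseteq> mspace X \<and> S \<subseteq> (\<Union>x\<in>K. mball_of X x \<epsilon>))"
    (is "?l \<longleftrightarrow> S \<subseteq> mspace X \<and> ?r")
proof -
  interpret Metric_space "mspace X" "mdist X" by (rule Metric_space_mspace_mdist)
  have l_iff: "?l \<longleftrightarrow> (\<forall>\<epsilon>>0. \<exists>K. finite K \<and> K \<subseteq> S \<and> S \<subseteq> (\<Union>x\<in>K. mball_of X x \<epsilon>))"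
    unfolding precompact_in_def mtotally_bounded_def mball_of_def by (rule refl)
  have sub: "S \<subseteq> mspace X" if ?l
    using that unfolding precompact_in_def by (rule mtotally_bounded_imp_subset)
  have "?r" if ?l
  proof (intro allI impI)
    fix \<epsilon> :: real assume "\<epsilon> > 0"
    with that obtain K where "finite K" "K \<subseteq> S" "S \<subseteq> (\<Union>x\<in>K. mball_of X x \<epsilon>)"
      unfolding l_iff by meson
    moreover have "K \<subseteq> mspace X"
      using \<open>K \<subseteq> S\<close> sub[OF that] by (rule subset_trans)
    ultimately show "\<exists>K. finite K \<and> K \<subseteq> mspace X \<and> S \<subseteq> (\<Union>x\<in>K. mball_of X x \<epsilon>)"
      by (intro exI conjI)
  qed
  moreover have ?l if r: ?r
    unfolding l_iff
  proof (intro allI impI)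
    fix \<epsilon> :: real assume "\<epsilon> > 0"
    then have "\<epsilon> / 2 > 0" by simp
    with r obtain K where K: "finite K" "S \<subseteq> (\<Union>x\<in>K. mball_of X x (\<epsilon>/2))"
      by meson
    define K' where "K' = {x \<in> K. S \<inter> mball_of X x (\<epsilon>/2) \<noteq> {}}"
    define c where "c x = (SOME y. y \<in> S \<inter> mball_of X x (\<epsilon>/2))" for x
    have c: "c x \<in> S \<inter> mball_of X x (\<epsilon>/2)" if "x \<in> K'" for x
      using that unfolding K'_def c_def by (simp add: some_in_eq del: Int_iff)
    have "S \<subseteq> (\<Union>x\<in>c ` K'. mball_of X x \<epsilon>)"
    proof
      fix y assume y: "y \<in> S"
      then obtain x where x: "x \<in> K" "y \<in> mball_of X x (\<epsilon>/2)" using K(2) by (meson UN_E subsetD)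
      have "S \<inter> mball_of X x (\<epsilon>/2) \<noteq> {}" using IntI[OF y x(2)] by (metis emptyE)
      with x(1) have xK: "x \<in> K'" unfolding K'_def by (intro CollectI conjI)
      note cx = IntD2[OF c[OF xK]]
      have "mdist X (c x) y \<le> mdist X (c x) x + mdist X x y"
        by (rule triangle) (use x(2) cx in simp_all)
      moreover have "mdist X x y < \<epsilon>/2" "mdist X (c x) x < \<epsilon>/2"
        using x(2) cx commute[of "c x" x] by simp_all
      ultimately have "y \<in> mball_of X (c x) \<epsilon>" using x(2) cx by simp
      with xK show "y \<in> (\<Union>x\<in>c ` K'. mball_of X x \<epsilon>)" by (meson UN_I imageI)
    qed
    moreover have "finite (c ` K')"
      using K(1) by (simp add: K'_def)
    moreover have "c ` K' \<subseteq> S"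
      using IntD1[OF c] by (rule image_subsetI)
    ultimately show "\<exists>K. finite K \<and> K \<subseteq> S \<and> S \<subseteq> (\<Union>x\<in>K. mball_of X x \<epsilon>)"
      by (intro exI conjI)
  qed
  ultimately show ?thesis using sub by (intro iffI conjI) simp_all
qed

definition PK :: "'a metric \<Rightarrow> 'a set set" where
  "PK X = {A. A \<subseteq> mspace X \<and> precompact_in X A}"

definition dense_in :: "'a metric \<Rightarrow> 'a set \<Rightarrow> bool" where
  "dense_in X D \<longleftrightarrow> D \<subseteq> mspace X \<and> mtopology_of X closure_of D = mspace X"

definition completion_of :: "'a metric \<Rightarrow> 'b metric \<Rightarrow> bool" where
  "completion_of X Y \<longleftrightarrow> mcomplete_of Y \<and>
    (\<exists>\<iota>. (\<forall>x\<in>mspace X. \<forall>y\<in>mspace X. mdist Y (\<iota> x) (\<iota> y) = mdist X x y) \<and>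
         dense_in Y (\<iota> ` mspace X))"

lemma completion_of_exists: "\<exists>Y :: ('a \<Rightarrow> real) metric. completion_of (X :: 'a metric) Y"
proof -
  interpret Metric_space "mspace X" "mdist X" by simp
  obtain f :: "'a \<Rightarrow> 'a \<Rightarrow> real" and Y where
    "mcomplete_of Y" "f \<in> mspace X \<rightarrow> mspace Y"
    "mtopology_of Y closure_of f ` mspace X = mspace Y"
    "\<And>x y. \<lbrakk>x \<in> mspace X; y \<in> mspace X\<rbrakk> \<Longrightarrow> mdist Y (f x) (f y) = mdist X x y"
    by (rule metric_completion) (rule that)
  then have "completion_of X Y"
    unfolding completion_of_def dense_in_def by (intro conjI exI[of _ f] ballI) auto
  then show ?thesis ..
qed

context includes cardinal_syntax
begin

text \<open>Cardinals are represented, as in the library, by well-order relations \<open>r\<close> satisfying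
  \<open>Card_order r\<close>; the set underlying such a cardinal is \<open>Field r\<close>.\<close>

definition density_card :: "'a metric \<Rightarrow> 'a rel" where
  "density_card X = |SOME D. dense_in X D \<and> (\<forall>D'. dense_in X D' \<longrightarrow> |D| \<le>o |D'| )|"

lemma density_card_min:
  shows density_Card_order: "Card_order (density_card X)"
    and density_attained: "\<exists>D. dense_in X D \<and> density_card X = |D|"
    and density_le: "dense_in X D' \<Longrightarrow> density_card X \<le>o |D'|"
proof -
  let ?R = "card_of ` Collect (dense_in X)"
  have "dense_in X (mspace X)"
    using closure_of_topspace[of "mtopology_of X"] by (simp add: dense_in_def)
  then have "?R \<noteq> {}" by blast
  moreover have "\<forall>r\<in>?R. Card_order r" by (auto simp: card_of_Card_order)
  ultimately have "\<exists>r\<in>?R. \<forall>r'\<in>?R. r \<le>o r'" by (rule exists_minim_Card_order)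
  then have "\<exists>D. dense_in X D \<and> (\<forall>D'. dense_in X D' \<longrightarrow> |D| \<le>o |D'| )" by blast
  note D = someI_ex[OF this]
  show "\<exists>D. dense_in X D \<and> density_card X = |D|"
    unfolding density_card_def by (rule exI, rule conjI, rule D[THEN conjunct1], rule refl)
  show "density_card X \<le>o |D'|" if "dense_in X D'"
    unfolding density_card_def using D[THEN conjunct2] that by simp
  show "Card_order (density_card X)"
    unfolding density_card_def by (rule card_of_Card_order)
qed

end

definition cofinal_in :: "'q::order set \<Rightarrow> 'q set \<Rightarrow> bool" where
  "cofinal_in Q C \<longleftrightarrow> C \<subseteq> Q \<and> (\<forall>q\<in>Q. \<exists>c\<in>C. q \<le> c)"

definition cofinally_below :: "'p::order set \<Rightarrow> 'q::order set \<Rightarrow> bool" where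
  "cofinally_below P Q \<longleftrightarrow> (\<exists>\<psi>. \<psi> \<in> P \<rightarrow> Q \<and> mono_on P \<psi> \<and> cofinal_in Q (\<psi> ` P))"

definition cofinally_equivalent :: "'p::order set \<Rightarrow> 'q::order set \<Rightarrow> bool" where
  "cofinally_equivalent P Q \<longleftrightarrow> cofinally_below P Q \<and> cofinally_below Q P"

end

theory Submission
  imports Defs
begin

text \<open>Both maps are read off a function \<open>r > 0\<close> on \<open>X\<close> such that each ball \<open>B(x, r x)\<close> is
  precompact and \<open>r\<close> is bounded away from \<open>0\<close> near every precompact set (a \<open>precompact_gauge\<close>).
  Local compactness of the completion \<open>Y\<close> supplies it: the closure of a precompact set in \<open>Y\<close>
  is compact, hence has a compact neighbourhood, so the precompact set has a uniform neighbourhood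
  in \<open>X\<close> that is still precompact (\<open>precompact_neighbourhood\<close>). The largest radius of the
  form \<open>1 / (n + 1)\<close> whose ball is precompact is then a gauge.

  Let \<open>D\<close> be a dense set of minimal cardinality. To go from \<open>Fin(D)\<close> to \<open>PK(X)\<close>, send a finite
  set \<open>F\<close> to the union of the balls \<open>B(x, r x)\<close>, \<open>x \<in> F\<close>. This is cofinal because near a
  precompact set the gauge balls are not small, so finitely many of them with centres in \<open>D\<close>
  cover it (\<open>precompact_gauge_finite_cover\<close>).

  To go back, take a maximal set \<open>E\<close> with \<open>d x y \<ge> min (r x) (r y)\<close> for distinct points
  (\<open>precompact_gauge_separated\<close>). On a precompact set \<open>r\<close> is bounded below, so \<open>E\<close> meets it
  in a uniformly separated, hence finite, set. By maximality the gauge balls around \<open>E\<close> cover \<open>X\<close>.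
  So \<open>E\<close> is infinite, for otherwise \<open>X\<close> would be precompact, and, since precompact sets are
  separable, \<open>X\<close> has a dense set of size at most that of \<open>E\<close>. Thus \<open>D\<close> injects into \<open>E\<close> by
  some \<open>h\<close>, and \<open>A \<mapsto> {x \<in> D. h x \<in> A}\<close> is a monotone map from \<open>PK(X)\<close> onto \<open>Fin(D)\<close>.\<close>

section \<open>Total boundedness\<close>

lemma (in Metric_space) mtotally_bounded_finite_net:
  assumes "mtotally_bounded S" and "\<epsilon> > 0"
  obtains K where "finite K" "K \<subseteq> S" "S \<subseteq> (\<Union>x\<in>K. mball x \<epsilon>)"
  using assms unfolding mtotally_bounded_def by meson

lemma mtotally_bounded_isometric_image:
  assumes "Metric_space M d" and "Metric_space N e"
    and "S \<subseteq> M" and "f ` S \<subseteq> N"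
    and iso: "\<And>x y. x \<in> S \<Longrightarrow> y \<in> S \<Longrightarrow> e (f x) (f y) = d x y"
  shows "Metric_space.mtotally_bounded N e (f ` S) \<longleftrightarrow> Metric_space.mtotally_bounded M d S"
proof -
  interpret M: Metric_space M d by fact
  interpret N: Metric_space N e by fact
  have ball: "f x \<in> N.mball (f y) \<epsilon> \<longleftrightarrow> x \<in> M.mball y \<epsilon>" if "x \<in> S" "y \<in> S" for x y \<epsilon>
    using that assms(3,4) by (auto simp: iso)
  have cover: "f ` S \<subseteq> (\<Union>z\<in>f ` K. N.mball z \<epsilon>) \<longleftrightarrow> S \<subseteq> (\<Union>z\<in>K. M.mball z \<epsilon>)"
    if "K \<subseteq> S" for K \<epsilon>
  proof -
    have "f ` S \<subseteq> (\<Union>z\<in>f ` K. N.mball z \<epsilon>) \<longleftrightarrow> (\<forall>x\<in>S. \<exists>z\<in>K. f x \<in> N.mball (f z) \<epsilon>)"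
      by (simp add: image_subset_iff del: N.in_mball)
    also have "\<dots> \<longleftrightarrow> (\<forall>x\<in>S. \<exists>z\<in>K. x \<in> M.mball z \<epsilon>)"
    proof (intro ball_cong bex_cong refl)
      fix x z assume "x \<in> S" "z \<in> K"
      then show "f x \<in> N.mball (f z) \<epsilon> \<longleftrightarrow> x \<in> M.mball z \<epsilon>"
        using ball that by (meson subsetD)
    qed
    also have "\<dots> \<longleftrightarrow> S \<subseteq> (\<Union>z\<in>K. M.mball z \<epsilon>)"
      unfolding Ball_def subset_iff UN_iff by (rule refl)
    finally show ?thesis .
  qed
  show ?thesis
  proof
    assume N: "N.mtotally_bounded (f ` S)"
    show "M.mtotally_bounded S"
      unfolding M.mtotally_bounded_def
    proof (intro allI impI)
      fix \<epsilon> :: real assume "\<epsilon> > 0"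
      with N obtain K' where K': "finite K'" "K' \<subseteq> f ` S" "f ` S \<subseteq> (\<Union>x\<in>K'. N.mball x \<epsilon>)"
        by (rule N.mtotally_bounded_finite_net)
      then obtain K where K: "K \<subseteq> S" "finite K" "K' = f ` K"
        using finite_subset_image by metis
      moreover have "S \<subseteq> (\<Union>x\<in>K. M.mball x \<epsilon>)"
        using cover[OF K(1), THEN iffD1] K'(3) unfolding K(3) .
      ultimately show "\<exists>K. finite K \<and> K \<subseteq> S \<and> S \<subseteq> (\<Union>x\<in>K. M.mball x \<epsilon>)"
        by (intro exI conjI)
    qed
  next
    assume M: "M.mtotally_bounded S"
    show "N.mtotally_bounded (f ` S)"
      unfolding N.mtotally_bounded_def
    proof (intro allI impI)
      fix \<epsilon> :: real assume "\<epsilon> > 0"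
      with M obtain K where K: "finite K" "K \<subseteq> S" "S \<subseteq> (\<Union>x\<in>K. M.mball x \<epsilon>)"
        by (rule M.mtotally_bounded_finite_net)
      then show "\<exists>K. finite K \<and> K \<subseteq> f ` S \<and> f ` S \<subseteq> (\<Union>x\<in>K. N.mball x \<epsilon>)"
        using cover[OF K(2), THEN iffD2, OF K(3)]
        by (intro exI[of _ "f ` K"] conjI finite_imageI image_mono)
    qed
  qed
qed

context Metric_space
begin

lemma mtotally_bounded_separated_imp_finite:
  assumes "mtotally_bounded S" and "\<delta> > 0"
    and sep: "\<And>x y. x \<in> S \<Longrightarrow> y \<in> S \<Longrightarrow> x \<noteq> y \<Longrightarrow> \<delta> \<le> d x y"
  shows "finite S"
proof -
  obtain K where K: "finite K" "K \<subseteq> S" "S \<subseteq> (\<Union>x\<in>K. mball x \<delta>)"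
    using assms(1,2) by (rule mtotally_bounded_finite_net)
  have "S \<subseteq> K"
  proof
    fix y assume "y \<in> S"
    then obtain x where x: "x \<in> K" "d x y < \<delta>" using K(3) by auto
    have "x = y"
      using sep[of x y] x \<open>y \<in> S\<close> K(2) by force
    with x show "y \<in> K" by simp
  qed
  with K(1) show ?thesis by (rule finite_subset[rotated])
qed

lemma mtotally_bounded_imp_separable:
  assumes "mtotally_bounded S"
  obtains C where "countable C" "C \<subseteq> S" "S \<subseteq> mtopology closure_of C"
proof -
  have "\<forall>n::nat. \<exists>K. finite K \<and> K \<subseteq> S \<and> S \<subseteq> (\<Union>x\<in>K. mball x (1 / Suc n))"
    using assms unfolding mtotally_bounded_def by simp
  then obtain K where K: "\<And>n::nat. finite (K n)" "\<And>n. K n \<subseteq> S"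
    "\<And>n. S \<subseteq> (\<Union>x\<in>K n. mball x (1 / Suc n))"
    by metis
  show thesis
  proof
    show "countable (\<Union>n. K n)" using K(1) by (simp add: countable_finite)
    show "(\<Union>n. K n) \<subseteq> S" using K(2) by blast
    show "S \<subseteq> mtopology closure_of (\<Union>n. K n)"
      unfolding metric_closure_of
    proof (intro subsetI CollectI conjI allI impI)
      fix y assume y: "y \<in> S"
      then show yM: "y \<in> M" using mtotally_bounded_imp_subset[OF assms] by blast
      fix \<rho> :: real assume "\<rho> > 0"
      then obtain n where n: "1 / Suc n < \<rho>" using nat_approx_posE by blast
      obtain x where x: "x \<in> K n" "y \<in> mball x (1 / Suc n)" using K(3) y by blast
      then have "x \<in> mball y \<rho>" using n by (simp add: commute)
      with x(1) show "\<exists>x\<in>\<Union>n. K n. x \<in> mball y \<rho>" by blast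
    qed
  qed
qed

section \<open>Gauges of precompact balls\<close>

text \<open>The bound \<open>\<delta> \<le> r x\<close> is demanded in a uniform neighbourhood of \<open>A\<close>, and not only on \<open>A\<close>,
  since the points of a given dense set that approximate \<open>A\<close> need not belong to \<open>A\<close>.\<close>

definition precompact_gauge :: "('a \<Rightarrow> real) \<Rightarrow> bool" where
  "precompact_gauge r \<longleftrightarrow>
    (\<forall>x\<in>M. r x > 0 \<and> mtotally_bounded (mball x (r x))) \<and>
    (\<forall>A. mtotally_bounded A \<longrightarrow> (\<exists>\<delta>>0. \<forall>a\<in>A. \<forall>x\<in>mball a \<delta>. \<delta> \<le> r x))"

text \<open>Taking the largest precompact ball among the radii \<open>1 / (n + 1)\<close> makes lower bounds for \<open>r\<close>
  easy: every such radius that gives a precompact ball around \<open>x\<close> is at most \<open>r x\<close>. If the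
  \<open>\<delta>\<close>-neighbourhood of \<open>A\<close> is precompact, this applies with radii below \<open>\<delta> / 2\<close> to all points
  within \<open>\<delta> / 2\<close> of \<open>A\<close>.\<close>

lemma precompact_gauge_exists:
  assumes nbhd: "\<And>A. mtotally_bounded A \<Longrightarrow> \<exists>\<delta>>0. mtotally_bounded (\<Union>a\<in>A. mball a \<delta>)"
  obtains r where "precompact_gauge r"
proof -
  define n where "n x = (LEAST n::nat. mtotally_bounded (mball x (1 / Suc n)))" for x
  define r where "r x = 1 / Suc (n x)" for x
  have pos: "r x > 0" for x by (simp add: r_def)
  have r_ge: "1 / Suc k \<le> r x" if "mtotally_bounded (mball x (1 / Suc k))" for x and k :: nat
    using Least_le[of "\<lambda>n. mtotally_bounded (mball x (1 / Suc n))" k, OF that]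
    by (simp add: r_def n_def frac_le)
  have ball: "mtotally_bounded (mball x (r x))" if "x \<in> M" for x
  proof -
    have "\<exists>\<delta>>0. mtotally_bounded (mball x \<delta>)"
      using nbhd[of "{x}"] that by simp
    then obtain \<delta> where \<delta>: "\<delta> > 0" "mtotally_bounded (mball x \<delta>)" by blast
    obtain k where "1 / Suc k < \<delta>" using nat_approx_posE[OF \<delta>(1)] by blast
    then have "mtotally_bounded (mball x (1 / Suc k))"
      using mtotally_bounded_subset[OF \<delta>(2)] mball_subset_concentric by (metis less_imp_le)
    then show ?thesis unfolding r_def n_def by (rule LeastI)
  qed
  have bound: "\<exists>\<delta>>0. \<forall>a\<in>A. \<forall>x\<in>mball a \<delta>. \<delta> \<le> r x" if A: "mtotally_bounded A" for A
  proof -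
    obtain \<delta> where \<delta>: "\<delta> > 0" "mtotally_bounded (\<Union>a\<in>A. mball a \<delta>)"
      using nbhd[OF A] by blast
    obtain k where k: "1 / Suc k < \<delta> / 2" using nat_approx_posE[of "\<delta> / 2"] \<delta>(1) by auto
    have "1 / Suc k \<le> r x" if "a \<in> A" "x \<in> mball a (1 / Suc k)" for a x
    proof (rule r_ge, rule mtotally_bounded_subset[OF \<delta>(2)])
      have "mball x (1 / Suc k) \<subseteq> mball a \<delta>"
        by (rule mball_subset) (use that k in \<open>auto simp: commute\<close>)
      with that(1) show "mball x (1 / Suc k) \<subseteq> (\<Union>a\<in>A. mball a \<delta>)" by blast
    qed
    then show ?thesis by (intro exI[of _ "1 / Suc k"]) auto
  qed
  from pos ball bound have "precompact_gauge r" by (simp add: precompact_gauge_def)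
  then show thesis by (rule that)
qed

text \<open>Replace each centre of a finite net of \<open>A\<close> by a nearby point of \<open>D\<close>; the mesh is half the
  lower bound for \<open>r\<close> near \<open>A\<close>, so the gauge ball around the new centre contains the old ball.\<close>

lemma precompact_gauge_finite_cover:
  assumes r: "precompact_gauge r" and D: "mtopology closure_of D = M"
    and A: "mtotally_bounded A"
  obtains F where "finite F" "F \<subseteq> D" "A \<subseteq> (\<Union>x\<in>F. mball x (r x))"
proof -
  obtain \<delta> where \<delta>: "\<delta> > 0" "\<And>a x. a \<in> A \<Longrightarrow> x \<in> mball a \<delta> \<Longrightarrow> \<delta> \<le> r x"
    using r A unfolding precompact_gauge_def by metis
  obtain K where K: "finite K" "K \<subseteq> A" "A \<subseteq> (\<Union>x\<in>K. mball x (\<delta> / 2))"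
    using A half_gt_zero[OF \<delta>(1)] by (rule mtotally_bounded_finite_net)
  have "\<forall>a\<in>K. \<exists>x\<in>D. x \<in> mball a (\<delta> / 2)"
  proof
    fix a assume "a \<in> K"
    then have "a \<in> mtopology closure_of D"
      using K(2) D mtotally_bounded_imp_subset[OF A] by blast
    then show "\<exists>x\<in>D. x \<in> mball a (\<delta> / 2)"
      using \<delta>(1) unfolding metric_closure_of by (auto simp del: in_mball)
  qed
  then obtain p where p: "\<And>a. a \<in> K \<Longrightarrow> p a \<in> D" "\<And>a. a \<in> K \<Longrightarrow> p a \<in> mball a (\<delta> / 2)"
    by metis
  show thesis
  proof
    show "finite (p ` K)" using K(1) by simp
    show "p ` K \<subseteq> D" using p(1) by blast
    have "mball a (\<delta> / 2) \<subseteq> mball (p a) (r (p a))" if "a \<in> K" for a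
    proof (rule mball_subset)
      have "\<delta> \<le> r (p a)"
        using \<delta> K(2) that p(2)[OF that] by (intro \<delta>(2)[of a]) auto
      then show "d a (p a) + \<delta> / 2 \<le> r (p a)" "p a \<in> M"
        using p(2)[OF that] by auto
    qed
    then have "(\<Union>a\<in>K. mball a (\<delta> / 2)) \<subseteq> (\<Union>a\<in>K. mball (p a) (r (p a)))"
      by (intro UN_mono subset_refl)
    then show "A \<subseteq> (\<Union>x\<in>p ` K. mball x (r x))"
      unfolding image_image by (rule subset_trans[OF K(3)])
  qed
qed

text \<open>Separating by the smaller of the two radii makes maximality usable without any continuity of
  \<open>r\<close>: a point that cannot be added lies in the gauge ball of a point of \<open>E\<close>, whichever of
  the two radii is the smaller.\<close>

lemma precompact_gauge_separated:
  assumes r: "precompact_gauge r"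
  obtains E where "E \<subseteq> M" "\<And>A. mtotally_bounded A \<Longrightarrow> finite (A \<inter> E)"
    "M = (\<Union>x\<in>E. mball x (r x))"
proof -
  have pos: "r x > 0" if "x \<in> M" for x using r that by (simp add: precompact_gauge_def)
  define sep where "sep E \<longleftrightarrow> pairwise (\<lambda>x y. min (r x) (r y) \<le> d x y) E" for E
  have "\<exists>E\<in>{E. E \<subseteq> M \<and> sep E}. \<forall>E'\<in>{E. E \<subseteq> M \<and> sep E}. E \<subseteq> E' \<longrightarrow> E' = E"
  proof (rule subset_Zorn', intro CollectI conjI)
    fix \<C> assume "subset.chain {E. E \<subseteq> M \<and> sep E} \<C>"
    then have \<C>: "\<And>E. E \<in> \<C> \<Longrightarrow> E \<subseteq> M \<and> sep E"
      "\<And>E E'. E \<in> \<C> \<Longrightarrow> E' \<in> \<C> \<Longrightarrow> E \<subseteq> E' \<or> E' \<subseteq> E"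
      unfolding subset.chain_def by blast+
    then show "\<Union>\<C> \<subseteq> M" by blast
    show "sep (\<Union>\<C>)"
      unfolding sep_def pairwise_def
    proof (intro ballI impI)
      fix x y assume "x \<in> \<Union>\<C>" "y \<in> \<Union>\<C>" and "x \<noteq> y"
      then obtain E where "E \<in> \<C>" "x \<in> E" "y \<in> E" using \<C>(2) by blast
      with \<C>(1) \<open>x \<noteq> y\<close> show "min (r x) (r y) \<le> d x y" by (auto simp: sep_def pairwise_def)
    qed
  qed
  then obtain E where E: "E \<subseteq> M" "sep E"
    and maximal: "\<forall>E'\<in>{E. E \<subseteq> M \<and> sep E}. E \<subseteq> E' \<longrightarrow> E' = E"
    by (elim bexE CollectE conjE)
  show thesis
  proof
    show "finite (A \<inter> E)" if A: "mtotally_bounded A" for A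
    proof -
      obtain \<delta> where \<delta>: "\<delta> > 0" "\<And>a x. a \<in> A \<Longrightarrow> x \<in> mball a \<delta> \<Longrightarrow> \<delta> \<le> r x"
        using r A unfolding precompact_gauge_def by metis
      have "\<delta> \<le> r a" if "a \<in> A" for a
        using \<delta>(2)[OF that, of a] \<delta>(1) that mtotally_bounded_imp_subset[OF A] by auto
      then have "\<delta> \<le> min (r x) (r y)" if "x \<in> A" "y \<in> A" for x y
        using that by simp
      moreover have "min (r x) (r y) \<le> d x y" if "x \<in> E" "y \<in> E" "x \<noteq> y" for x y
        using E(2) that unfolding sep_def pairwise_def by blast
      ultimately have "\<delta> \<le> d x y" if "x \<in> A \<inter> E" "y \<in> A \<inter> E" "x \<noteq> y" for x y
        using that by (meson IntE order_trans)
      with mtotally_bounded_subset[OF A Int_lower1] \<delta>(1) show ?thesis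
        by (rule mtotally_bounded_separated_imp_finite)
    qed
    have "y \<in> (\<Union>x\<in>E. mball x (r x))" if y: "y \<in> M" for y
    proof (rule ccontr)
      assume *: "y \<notin> (\<Union>x\<in>E. mball x (r x))"
      then have far: "r x \<le> d x y" if "x \<in> E" for x
        using that E(1) y by force
      have "sep (insert y E)"
        using E(2) far by (auto simp: sep_def pairwise_insert commute min.coboundedI1 min.coboundedI2)
      with E(1) y have "insert y E \<in> {E. E \<subseteq> M \<and> sep E}" by simp
      then have "insert y E = E" by (rule maximal[THEN bspec, THEN mp, OF _ subset_insertI])
      then have "y \<in> E" by blast
      with far[of y] pos[OF y] y show False by simp
    qed
    then show "M = (\<Union>x\<in>E. mball x (r x))" by auto
  qed (fact E(1))
qed

end

text \<open>Collect a countable dense subset of each ball; as \<open>E\<close> is infinite, this does not increase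
  the cardinality.\<close>

lemma density_le_of_precompact_cover:
  includes cardinal_syntax
  assumes "infinite E" and B: "\<And>x. x \<in> E \<Longrightarrow> precompact_in X (B x)"
    and cover: "mspace X \<subseteq> (\<Union>x\<in>E. B x)"
  shows "density_card X \<le>o |E|"
proof -
  interpret Metric_space "mspace X" "mdist X" by simp
  have "\<forall>x\<in>E. \<exists>C. countable C \<and> C \<subseteq> B x \<and> B x \<subseteq> mtopology_of X closure_of C"
    using B mtotally_bounded_imp_separable
    unfolding precompact_in_def mtopology_of_def by metis
  then obtain C where C: "\<And>x. x \<in> E \<Longrightarrow> countable (C x)" "\<And>x. x \<in> E \<Longrightarrow> C x \<subseteq> B x"
    "\<And>x. x \<in> E \<Longrightarrow> B x \<subseteq> mtopology_of X closure_of (C x)"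
    by metis
  let ?C = "\<Union>x\<in>E. C x"
  have "dense_in X ?C"
    unfolding dense_in_def
  proof (intro conjI subset_antisym)
    show "?C \<subseteq> mspace X"
      using B C(2) mtotally_bounded_imp_subset unfolding precompact_in_def by blast
    show "mtopology_of X closure_of ?C \<subseteq> mspace X"
      using closure_of_subset_topspace[of "mtopology_of X"] by simp
    have "C x \<subseteq> ?C" if "x \<in> E" for x using that by blast
    then show "mspace X \<subseteq> mtopology_of X closure_of ?C"
      using cover C(3) closure_of_mono by (smt (verit) UN_E subset_iff)
  qed
  then have "density_card X \<le>o |?C|" by (rule density_le)
  also have "|?C| \<le>o |E|"
  proof (rule card_of_UNION_ordLeq_infinite[OF assms(1)])
    show "|E| \<le>o |E|" by (rule card_of_mono1) simp
    have "|C x| \<le>o |E|" if "x \<in> E" for x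
    proof -
      have "|C x| \<le>o |UNIV :: nat set|"
        using C(1)[OF that] unfolding countable_def by (auto simp flip: card_of_ordLeq)
      also have "|UNIV :: nat set| \<le>o |E|"
        using assms(1) by (simp add: infinite_iff_card_of_nat)
      finally show ?thesis .
    qed
    then show "\<forall>x\<in>E. |C x| \<le>o |E|" by blast
  qed
  finally show ?thesis .
qed

section \<open>Locally compact completions\<close>

text \<open>Pass to the completion: the closure of \<open>A\<close> there is compact, so it lies in an open set \<open>U\<close>
  inside a compact set \<open>L\<close>, and a Lebesgue number for the cover \<open>{U}\<close> gives a uniform
  neighbourhood inside \<open>L\<close>.\<close>

lemma precompact_neighbourhood:
  assumes "completion_of X Y" and "locally_compact_space (mtopology_of Y)"
    and A: "precompact_in X A"
  shows "\<exists>\<delta>>0. precompact_in X (\<Union>a\<in>A. mball_of X a \<delta>)"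
proof -
  interpret X: Metric_space "mspace X" "mdist X" by simp
  interpret Y: Metric_space "mspace Y" "mdist Y" by simp
  obtain \<iota> where iso: "\<And>x y. x \<in> mspace X \<Longrightarrow> y \<in> mspace X \<Longrightarrow> mdist Y (\<iota> x) (\<iota> y) = mdist X x y"
    and \<iota>: "\<iota> ` mspace X \<subseteq> mspace Y"
    using assms(1) unfolding completion_of_def dense_in_def by (elim conjE exE) (rule that, simp_all)
  have tb_iff: "Y.mtotally_bounded (\<iota> ` S) \<longleftrightarrow> X.mtotally_bounded S" if "S \<subseteq> mspace X" for S
  proof (rule mtotally_bounded_isometric_image)
    show "\<iota> ` S \<subseteq> mspace Y" using \<iota> image_mono[OF that] by (rule subset_trans[rotated])
    show "mdist Y (\<iota> x) (\<iota> y) = mdist X x y" if "x \<in> S" "y \<in> S" for x y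
      using that \<open>S \<subseteq> mspace X\<close> by (intro iso) auto
  qed (use that in simp_all)
  have AX: "A \<subseteq> mspace X" using A X.mtotally_bounded_imp_subset by (simp add: precompact_in_def)
  have \<iota>A: "Y.mtotally_bounded (\<iota> ` A)" using A tb_iff[OF AX] by (simp add: precompact_in_def)
  have "Y.mcomplete" using assms(1) by (simp add: completion_of_def mcomplete_of_def)
  then have "compactin Y.mtopology (Y.mtopology closure_of (\<iota> ` A))"
    using \<iota>A Y.mtotally_bounded_eq_compact_closure_of by blast
  moreover have "locally_compact_space Y.mtopology"
    using assms(2) by (simp add: mtopology_of_def)
  ultimately obtain U L where UL: "openin Y.mtopology U" "compactin Y.mtopology L"
    "Y.mtopology closure_of (\<iota> ` A) \<subseteq> U" "U \<subseteq> L"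
    using locally_compact_space_compact_closed_compact[of Y.mtopology]
      Y.Hausdorff_space_mtopology by metis
  then obtain \<delta> where \<delta>: "\<delta> > 0" "\<forall>z\<in>Y.mtopology closure_of (\<iota> ` A). Y.mball z \<delta> \<subseteq> U"
    using Y.lebesgue_number[of "Y.mtopology closure_of (\<iota> ` A)" "{U}"]
      \<open>compactin Y.mtopology (Y.mtopology closure_of (\<iota> ` A))\<close> by auto
  let ?N = "\<Union>a\<in>A. mball_of X a \<delta>"
  have NX: "?N \<subseteq> mspace X" by auto
  have "\<iota> ` ?N \<subseteq> L"
  proof
    fix z assume "z \<in> \<iota> ` ?N"
    then obtain a x where a: "a \<in> A" "x \<in> mball_of X a \<delta>" "z = \<iota> x" by blast
    have "\<iota> a \<in> Y.mtopology closure_of (\<iota> ` A)"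
      using a(1) closure_of_subset[of "\<iota> ` A" Y.mtopology] AX \<iota> by auto
    moreover have "z \<in> Y.mball (\<iota> a) \<delta>"
      using a AX \<iota> by (auto simp: iso)
    ultimately show "z \<in> L" using \<delta>(2) UL(4) by blast
  qed
  then have "Y.mtotally_bounded (\<iota> ` ?N)"
    using Y.compactin_imp_mtotally_bounded[OF UL(2)] Y.mtotally_bounded_subset by blast
  then show ?thesis using tb_iff[OF NX] \<delta>(1) by (auto simp: precompact_in_def)
qed

section \<open>The cofinal equivalence\<close>

theorem theorem2p6:
  fixes X :: "'a metric" and Y :: "'b metric"
  assumes "\<not> precompact_in X (mspace X)"
    and "completion_of X Y"
    and "locally_compact_space (mtopology_of Y)"
  shows "cofinally_equivalent (PK X) (Fpow (Field (density_card X)))"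
proof -
  include cardinal_syntax
  interpret Metric_space "mspace X" "mdist X" by simp
  have PK: "PK X = Collect mtotally_bounded"
    using mtotally_bounded_imp_subset by (auto simp: PK_def precompact_in_def)
  obtain r where r: "precompact_gauge r"
    using precompact_neighbourhood[OF assms(2,3)]
    unfolding precompact_in_def mball_of_def by (rule precompact_gauge_exists)
  then have ball: "mtotally_bounded (mball x (r x))" if "x \<in> mspace X" for x
    using that by (simp add: precompact_gauge_def)
  have balls: "mtotally_bounded (\<Union>x\<in>F. mball x (r x))" if "finite F" "F \<subseteq> mspace X" for F
    using that ball by (intro mtotally_bounded_Union) auto
  obtain D where D: "dense_in X D" "density_card X = |D|"
    using density_attained by blast
  have Field: "Field (density_card X) = D" by (simp add: D(2) Field_card_of)
  have DX: "D \<subseteq> mspace X" and D_dense: "mtopology closure_of D = mspace X"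
    using D(1) by (simp_all add: dense_in_def mtopology_of_def)
  obtain E where E: "E \<subseteq> mspace X" "\<And>A. mtotally_bounded A \<Longrightarrow> finite (A \<inter> E)"
    "mspace X = (\<Union>x\<in>E. mball x (r x))"
    using precompact_gauge_separated[OF r] by blast
  have "infinite E"
    using balls[of E] E(1,3) assms(1) by (auto simp: precompact_in_def)
  then have "|D| \<le>o |E|"
    using density_le_of_precompact_cover[of E X "\<lambda>x. mball x (r x)"] ball E(1,3) D(2)
    by (auto simp: precompact_in_def)
  then obtain h where h: "inj_on h D" "h ` D \<subseteq> E"
    using card_of_ordLeq[of D E] by blast
  have "cofinally_below (PK X) (Fpow D)"
    unfolding cofinally_below_def
  proof (intro exI conjI)
    let ?\<psi> = "\<lambda>A. {x \<in> D. h x \<in> A}"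
    show psi: "?\<psi> \<in> PK X \<rightarrow> Fpow D"
    proof
      fix A assume "A \<in> PK X"
      then have "finite (A \<inter> E)" using E(2) by (simp add: PK)
      moreover have "inj_on h (?\<psi> A)" using h(1) by (rule inj_on_subset) blast
      moreover have "h ` ?\<psi> A \<subseteq> A \<inter> E" using h(2) by blast
      ultimately have "finite (?\<psi> A)"
        by (rule inj_on_finite[rotated 2])
      then show "?\<psi> A \<in> Fpow D" by (simp add: Fpow_def)
    qed
    show "mono_on (PK X) ?\<psi>" by (auto simp: mono_on_def)
    have "F \<in> ?\<psi> ` PK X" if "F \<in> Fpow D" for F
    proof
      have F: "F \<subseteq> D" "finite F" using that by (auto simp: Fpow_def)
      then show "F = ?\<psi> (h ` F)" using h(1) by (auto simp: inj_on_def)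
      show "h ` F \<in> PK X"
        using F h(2) E(1) by (auto simp: PK intro!: finite_imp_mtotally_bounded)
    qed
    then have "?\<psi> ` PK X = Fpow D"
      using subset_antisym[OF funcset_image[OF psi] subsetI] by simp
    then show "cofinal_in (Fpow D) (?\<psi> ` PK X)"
      by (simp only: cofinal_in_def) blast
  qed
  moreover have "cofinally_below (Fpow D) (PK X)"
    unfolding cofinally_below_def
  proof (intro exI conjI)
    let ?\<phi> = "\<lambda>F. \<Union>x\<in>F. mball x (r x)"
    show phi: "?\<phi> \<in> Fpow D \<rightarrow> PK X"
    proof
      fix F assume "F \<in> Fpow D"
      then have "finite F" "F \<subseteq> mspace X" using DX by (auto simp: Fpow_def)
      then show "?\<phi> F \<in> PK X" unfolding PK mem_Collect_eq by (rule balls)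
    qed
    show "mono_on (Fpow D) ?\<phi>" by (intro mono_onI UN_mono subset_refl)
    have "\<exists>F\<in>Fpow D. A \<subseteq> ?\<phi> F" if A: "A \<in> PK X" for A
    proof -
      obtain F where "finite F" "F \<subseteq> D" "A \<subseteq> ?\<phi> F"
        using A unfolding PK mem_Collect_eq by (rule precompact_gauge_finite_cover[OF r D_dense])
      then show ?thesis unfolding Fpow_def by (intro bexI[of _ F] CollectI conjI)
    qed
    then show "cofinal_in (PK X) (?\<phi> ` Fpow D)"
      unfolding cofinal_in_def using funcset_image[OF phi] by (simp only: bex_simps) simp
  qed
  ultimately show ?thesis by (simp add: cofinally_equivalent_def Field)
qed

end
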